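(* Let $n,k\ge 1$ be integers and let $\Phi:\mathbb{R}^n\to\mathbb{R}^k$ be a bijection. Then $R^n_k$, that is, the set $\mathbb{R}^n$ equipped with the operations $x\oplus y=\Phi^{-1}(\Phi(x)+\Phi(y))$ (vector addition) and $c\odot x=\Phi^{-1}(c\cdot\Phi(x))$ (scalar multiplication) for $x,y\in\mathbb{R}^n$ and $c\in\mathbb{R}$, is a vector space over the field $\mathbb{R}$ of dimension $k$.
   Context: Here $\mathbb{R}^n$ as the domain of $\Phi$ is regarded only as the set of all $n$-tuples of real numbers; $\mathbb{R}^k$ carries its standard coordinatewise real vector space structure, whose addition and scalar multiplication are denoted $+$ and $\cdot$. The map $\Phi$ is an arbitrary set-theoretic bijection (no linearity or continuity is assumed); such a bijection exists for all integers $n,k\ge 1$. $R^n_k$ denotes the set $\mathbb{R}^n$ with the operations $\oplus$ and $\odot$ defined from $\Phi$. *)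

theory Defs
  imports "Jordan_Normal_Form.VS_Connect"
begin

text \<open>
  The set of real $n$-tuples is \<^term>\<open>carrier_vec n :: real vec set\<close>, and the standard space of
  $k$-tuples is \<^term>\<open>module_vec TYPE(real) k\<close>. A map \<open>\<Phi>\<close> matters only on
  \<^term>\<open>carrier_vec n\<close>, so its inverse is taken relative to that set.
\<close>

definition oplus :: "nat \<Rightarrow> (real vec \<Rightarrow> real vec) \<Rightarrow> real vec \<Rightarrow> real vec \<Rightarrow> real vec" where
  "oplus n \<Phi> x y = inv_into (carrier_vec n) \<Phi> (\<Phi> x + \<Phi> y)"

definition odot :: "nat \<Rightarrow> (real vec \<Rightarrow> real vec) \<Rightarrow> real \<Rightarrow> real vec \<Rightarrow> real vec" where
  "odot n \<Phi> c x = inv_into (carrier_vec n) \<Phi> (c \<cdot>\<^sub>v \<Phi> x)"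

text \<open>
  The record type demands a zero element; the one below is the only element that can be neutral
  for \<^const>\<open>oplus\<close>. The fields \<open>mult\<close> and \<open>one\<close> are irrelevant for modules and left unspecified,
  as in \<^const>\<open>module_vec\<close>.
\<close>

definition Rnk :: "nat \<Rightarrow> nat \<Rightarrow> (real vec \<Rightarrow> real vec) \<Rightarrow> (real, real vec) module" where
  "Rnk n k \<Phi> = \<lparr>
    carrier = carrier_vec n,
    mult = undefined,
    one = undefined,
    zero = inv_into (carrier_vec n) \<Phi> (0\<^sub>v k),
    add = oplus n \<Phi>,
    smult = odot n \<Phi>\<rparr>"

end

theory Submission
  imports Defs
begin

text \<open>
  The operations \<^const>\<open>oplus\<close> and \<^const>\<open>odot\<close> are those of \<open>\<real>\<^sup>k\<close> carried over to \<open>\<real>\<^sup>n\<close> by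
  \<open>\<Phi>\<inverse>\<close>, so the inverse bijection \<open>\<Psi> : \<real>\<^sup>k \<rightarrow> \<real>\<^sup>n\<close> preserves the operations by their very definition.
  The vector space axioms are universally quantified equations, up to closure and the existence of
  negatives, and they pass to any image under a map that preserves the operations
  (\<open>vectorspace_surjective_image\<close>); so \<open>R\<^sup>n\<^sub>k\<close> is a vector space. Only after that is \<open>\<Psi>\<close> a
  linear map in the usual sense, and as a bijective one it preserves the dimension
  (\<open>dim_bijective_image\<close>).
\<close>

text \<open>
  The target is a bare structure here, and every law comes from the source: elements of the image
  are written as values of \<open>T\<close>, and \<open>T\<close> is pulled out of both sides of the law.
\<close>

lemma vectorspace_surjective_image:
  fixes K (structure)
  assumes "vectorspace K V"
    and surj: "T ` carrier V = carrier W"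
    and zero: "T \<zero>\<^bsub>V\<^esub> = \<zero>\<^bsub>W\<^esub>"
    and add: "\<And>x y. x \<in> carrier V \<Longrightarrow> y \<in> carrier V \<Longrightarrow> T x \<oplus>\<^bsub>W\<^esub> T y = T (x \<oplus>\<^bsub>V\<^esub> y)"
    and smult: "\<And>c x. c \<in> carrier K \<Longrightarrow> x \<in> carrier V \<Longrightarrow> c \<odot>\<^bsub>W\<^esub> T x = T (c \<odot>\<^bsub>V\<^esub> x)"
  shows "vectorspace K W"
proof -
  interpret V: vectorspace K V by fact
  note hom = zero [symmetric] add smult
  have "abelian_group W"
  proof (rule abelian_groupI, goal_cases)
    case (6 x)
    then obtain v where v: "v \<in> carrier V" "x = T v" using surj by blast
    then have "T (\<ominus>\<^bsub>V\<^esub> v) \<oplus>\<^bsub>W\<^esub> x = \<zero>\<^bsub>W\<^esub>" by (simp add: hom V.module.M.l_neg)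
    then show ?case using v surj by blast
  qed (auto simp: hom V.module.M.a_ac simp flip: surj)
  then have "module K W"
    by (intro moduleI)
      (auto simp: hom V.module.smult_l_distr V.module.smult_r_distr V.module.smult_assoc1
        intro: V.module.R.is_cring simp flip: surj)
  then show ?thesis
    by (intro vectorspace.intro V.field.field_axioms)
qed

text \<open>
  The image is a vector space by the preceding lemma, which makes \<open>T\<close> a linear isomorphism; then
  the rank-nullity theorem gives the dimension.
\<close>

lemma dim_bijective_image:
  fixes K (structure)
  assumes V: "vectorspace K V" and fin_dim_V: "vectorspace.fin_dim K V"
    and bij: "bij_betw T (carrier V) (carrier W)"
    and zero: "T \<zero>\<^bsub>V\<^esub> = \<zero>\<^bsub>W\<^esub>"
    and add: "\<And>x y. x \<in> carrier V \<Longrightarrow> y \<in> carrier V \<Longrightarrow> T x \<oplus>\<^bsub>W\<^esub> T y = T (x \<oplus>\<^bsub>V\<^esub> y)"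
    and smult: "\<And>c x. c \<in> carrier K \<Longrightarrow> x \<in> carrier V \<Longrightarrow> c \<odot>\<^bsub>W\<^esub> T x = T (c \<odot>\<^bsub>V\<^esub> x)"
  shows "vectorspace K W \<and> vectorspace.fin_dim K W \<and> vectorspace.dim K W = vectorspace.dim K V"
proof -
  have inj: "inj_on T (carrier V)" and surj: "T ` carrier V = carrier W"
    using bij by (auto simp: bij_betw_def)
  have W: "vectorspace K W"
    using V surj zero add smult by (rule vectorspace_surjective_image)
  have "T \<in> LinearCombinations.module_hom K V W"
    using surj add smult by (auto simp: LinearCombinations.module_hom_def)
  then interpret linear_map K V W T
    using V W by (intro linear_map.intro mod_hom.intro mod_hom_axioms.intro)
      (auto simp: vectorspace_def)
  show ?thesis
    using W surj_fin_dim [OF fin_dim_V surj] dim_eq [OF fin_dim_V inj surj] by simp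
qed

theorem corollary9:
  fixes n k :: nat and \<Phi> :: "real vec \<Rightarrow> real vec"
  assumes "n \<ge> 1" and "k \<ge> 1"
    and "bij_betw \<Phi> (carrier_vec n) (carrier_vec k)"
  shows "vectorspace (class_ring :: real ring) (Rnk n k \<Phi>)
    \<and> vectorspace.fin_dim (class_ring :: real ring) (Rnk n k \<Phi>)
    \<and> vectorspace.dim (class_ring :: real ring) (Rnk n k \<Phi>) = k"
proof -
  interpret Rk: vec_space "TYPE(real)" k .
  define \<Psi> where "\<Psi> = inv_into (carrier_vec n) \<Phi>"
  have \<Phi>\<Psi>: "\<Phi> (\<Psi> v) = v" if "v \<in> carrier_vec k" for v
    using assms(3) that by (simp add: \<Psi>_def bij_betw_inv_into_right)
  have "vectorspace class_ring (Rnk n k \<Phi>) \<and> vectorspace.fin_dim class_ring (Rnk n k \<Phi>)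
    \<and> vectorspace.dim class_ring (Rnk n k \<Phi>) = vectorspace.dim class_ring (module_vec TYPE(real) k)"
  proof (rule dim_bijective_image [where T = \<Psi>])
    show "bij_betw \<Psi> (carrier (module_vec TYPE(real) k)) (carrier (Rnk n k \<Phi>))"
      using bij_betw_inv_into [OF assms(3)] by (simp add: \<Psi>_def Rnk_def module_vec_simps)
  qed (use \<Phi>\<Psi> in \<open>auto simp: vec_vs Rnk_def oplus_def odot_def module_vec_simps
    simp flip: \<Psi>_def\<close>)
  then show ?thesis
    by (simp add: Rk.dim_is_n)
qed

end
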